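(* Suppose that the $\mathsf{PA}$-based Smullyan model $M_{\mathsf{PA}}$ satisfies FPT, i.e. for every $H\in\mathrm{Pred}$ there is $S\in\mathrm{Sent}^+$ such that $S\in\mathrm{True}_{M_{\mathsf{PA}}}\iff HS\in\mathrm{True}_{M_{\mathsf{PA}}}$. Then for every $v$-formula $\varphi_i(v)$ there exists an $\mathcal{L}_A$-sentence $\theta$ such that $\mathsf{PA}\vdash\theta\iff\mathsf{PA}\vdash\varphi_i(\ulcorner\theta\urcorner)$.
   Context: Arithmetic. $\mathcal{L}_A$ is the language of first-order arithmetic, containing a function symbol for each primitive recursive function. $\mathsf{PA}$ (Peano arithmetic) is the $\mathcal{L}_A$-theory consisting of the basic axioms of arithmetic (including defining equations of the primitive recursive function symbols) and the induction scheme. $\overline{n}$ is the numeral of $n$. Fix a natural Gödel numbering; $\ulcorner\psi\urcorner$ is the Gödel number of $\psi$, and inside formulas also its numeral. Fix a variable $v$. A $v$-formula is an $\mathcal{L}_A$-formula with no free variables other than $v$ (possibly none); $\varphi_i(v)$ is the $v$-formula with Gödel number $i$; $\Gamma$ is the set of Gödel numbers of $v$-formulas; $\psi(t)$ is the result of substituting the term $t$ for $v$ in $\psi(v)$. $d$ is the primitive recursive function (and its function symbol) with $d(i)=\ulcorner\varphi_i(\overline{i})\urcorner$ if $i\in\Gamma$ and $d(i)=0$ otherwise. $\equiv$ is syntactic identity. Frame. Let $\mathsf{r},a_i$ $(i\in\Gamma)$ be pairwise distinct symbols, $\Sigma=\{a_i: i\in\Gamma\}\cup\{\mathsf{r}\}$,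 $\Sigma^\ast$ the set of finite strings over $\Sigma$ (including the empty string $\epsilon$), $\mathrm{Pred}=\{\mathsf{r}^ja_i: j\in\mathbb{N}, i\in\Gamma\}$, $\mathrm{Sent}=\{HX: H\in\mathrm{Pred}, X\in\Sigma^\ast\}$ (the decomposition $HX$ is unique), $\mathrm{Sent}^+=\mathrm{Sent}\setminus\mathrm{Pred}$. Map $I$ from $\mathrm{Pred}$ to $v$-formulas: $I(a_i)\equiv\varphi_i(v)$; $I(\mathsf{r}a_i)\equiv\varphi_i(d(v))$; $I(\mathsf{r}^ja_i)\equiv\bot$ for $j\ge2$. Map $J$ from $\mathrm{Sent}$ to $\mathcal{L}_A$-sentences, defined inductively for $H\in\mathrm{Pred}$, $X\in\Sigma^\ast$: if $X\in\mathrm{Pred}$, $J(HX)\equiv I(H)(\ulcorner I(X)(v)\urcorner)$; if $X\notin\mathrm{Sent}$, $J(a_iX)\equiv I(a_i)(0)$ and $J(\mathsf{r}HX)\equiv\bot$; if $X\in\mathrm{Sent}^+$, $J(a_iX)\equiv I(a_i)(\ulcorner J(X)\urcorner)$ and $J(\mathsf{r}HX)\equiv\bot$. Model. $M_{\mathsf{PA}}=(\Sigma,\mathrm{Pred},\Phi_{\mathsf{PA}})$ with $\Phi_{\mathsf{PA}}(H)=\{X\in\Sigma^\ast: \mathsf{PA}\vdash J(HX)\}$. $\mathrm{True}_{M_{\mathsf{PA}}}=\{HX: H\in\mathrm{Pred}, X\in\Phi_{\mathsf{PA}}(H)\}$. *)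

theory Defs
  imports Main
begin

section \<open>The language of arithmetic\<close>

text \<open>Function symbols are definitions of primitive recursive functions, so every primitive
  recursive function has a symbol (one for each of its definitions). The arguments of
  \<open>Proj\<close> are arity and index; the first argument of \<open>Comp\<close> is the arity.\<close>

datatype pr = Zero | Succ | Proj nat nat | Comp nat pr "pr list" | PRec pr pr

fun arity :: "pr \<Rightarrow> nat" where
  "arity Zero = 0"
| "arity Succ = 1"
| "arity (Proj n k) = n"
| "arity (Comp n f gs) = n"
| "arity (PRec f g) = Suc (arity f)"

fun wf_pr :: "pr \<Rightarrow> bool" where
  "wf_pr Zero \<longleftrightarrow> True"
| "wf_pr Succ \<longleftrightarrow> True"
| "wf_pr (Proj n k) \<longleftrightarrow> k < n"
| "wf_pr (Comp n f gs) \<longleftrightarrow>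
     wf_pr f \<and> length gs = arity f \<and> (\<forall>g \<in> set gs. wf_pr g \<and> arity g = n)"
| "wf_pr (PRec f g) \<longleftrightarrow> wf_pr f \<and> wf_pr g \<and> arity g = arity f + 2"

text \<open>The function denoted by a symbol; meaningful on argument lists of length \<open>arity\<close>.\<close>

fun eval_pr :: "pr \<Rightarrow> nat list \<Rightarrow> nat" where
  "eval_pr Zero xs = 0"
| "eval_pr Succ xs = Suc (hd xs)"
| "eval_pr (Proj n k) xs = xs ! k"
| "eval_pr (Comp n f gs) xs = eval_pr f (map (\<lambda>g. eval_pr g xs) gs)"
| "eval_pr (PRec f g) xs =
     rec_nat (eval_pr f (tl xs)) (\<lambda>k r. eval_pr g (k # r # tl xs)) (hd xs)"

datatype tm = Var nat | Fn pr "tm list"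

datatype fm = Bot | Eq tm tm | Imp fm fm | All nat fm

text \<open>Only the well-formed terms and formulas are those of the language.\<close>

fun wf_tm :: "tm \<Rightarrow> bool" where
  "wf_tm (Var x) \<longleftrightarrow> True"
| "wf_tm (Fn f ts) \<longleftrightarrow> wf_pr f \<and> length ts = arity f \<and> (\<forall>t \<in> set ts. wf_tm t)"

fun wf_fm :: "fm \<Rightarrow> bool" where
  "wf_fm Bot \<longleftrightarrow> True"
| "wf_fm (Eq s t) \<longleftrightarrow> wf_tm s \<and> wf_tm t"
| "wf_fm (Imp p q) \<longleftrightarrow> wf_fm p \<and> wf_fm q"
| "wf_fm (All x p) \<longleftrightarrow> wf_fm p"

fun fv_tm :: "tm \<Rightarrow> nat set" where
  "fv_tm (Var x) = {x}"
| "fv_tm (Fn f ts) = (\<Union>t \<in> set ts. fv_tm t)"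

fun fv :: "fm \<Rightarrow> nat set" where
  "fv Bot = {}"
| "fv (Eq s t) = fv_tm s \<union> fv_tm t"
| "fv (Imp p q) = fv p \<union> fv q"
| "fv (All x p) = fv p - {x}"

definition sentence :: "fm \<Rightarrow> bool" where
  "sentence p \<longleftrightarrow> wf_fm p \<and> fv p = {}"

fun subst_tm :: "nat \<Rightarrow> tm \<Rightarrow> tm \<Rightarrow> tm" where
  "subst_tm x s (Var y) = (if y = x then s else Var y)"
| "subst_tm x s (Fn f ts) = Fn f (map (subst_tm x s) ts)"

text \<open>\<open>subst x s p\<close> replaces the free occurrences of \<open>x\<close> in \<open>p\<close> by \<open>s\<close> without renaming bound
  variables. No capture can occur if \<open>s\<close> contains at most the variable \<open>x\<close>; otherwise
  \<open>free_for x s p\<close> has to be required.\<close>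

fun subst :: "nat \<Rightarrow> tm \<Rightarrow> fm \<Rightarrow> fm" where
  "subst x s Bot = Bot"
| "subst x s (Eq t u) = Eq (subst_tm x s t) (subst_tm x s u)"
| "subst x s (Imp p q) = Imp (subst x s p) (subst x s q)"
| "subst x s (All y p) = All y (if y = x then p else subst x s p)"

fun free_for :: "nat \<Rightarrow> tm \<Rightarrow> fm \<Rightarrow> bool" where
  "free_for x s Bot \<longleftrightarrow> True"
| "free_for x s (Eq t u) \<longleftrightarrow> True"
| "free_for x s (Imp p q) \<longleftrightarrow> free_for x s p \<and> free_for x s q"
| "free_for x s (All y p) \<longleftrightarrow> x \<notin> fv (All y p) \<or> (y \<notin> fv_tm s \<and> free_for x s p)"

abbreviation zero :: tm where "zero \<equiv> Fn Zero []"
abbreviation suc :: "tm \<Rightarrow> tm" where "suc t \<equiv> Fn Succ [t]"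

fun num :: "nat \<Rightarrow> tm" where
  "num 0 = zero"
| "num (Suc n) = suc (num n)"

section \<open>Peano arithmetic\<close>

text \<open>A Hilbert calculus for classical first-order logic with equality. Generalisation is
  unrestricted, so an open formula among the axioms \<open>T\<close> amounts to its universal closure.\<close>

inductive provable :: "fm set \<Rightarrow> fm \<Rightarrow> bool" (infix "\<turnstile>" 50) for T where
  Ax: "p \<in> T \<Longrightarrow> T \<turnstile> p"
| K: "wf_fm p \<Longrightarrow> wf_fm q \<Longrightarrow> T \<turnstile> Imp p (Imp q p)"
| S: "wf_fm p \<Longrightarrow> wf_fm q \<Longrightarrow> wf_fm r \<Longrightarrow>
      T \<turnstile> Imp (Imp p (Imp q r)) (Imp (Imp p q) (Imp p r))"
| DN: "wf_fm p \<Longrightarrow> T \<turnstile> Imp (Imp (Imp p Bot) Bot) p"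
| Inst: "wf_fm p \<Longrightarrow> wf_tm t \<Longrightarrow> free_for x t p \<Longrightarrow> T \<turnstile> Imp (All x p) (subst x t p)"
| Distr: "wf_fm p \<Longrightarrow> wf_fm q \<Longrightarrow> x \<notin> fv p \<Longrightarrow>
      T \<turnstile> Imp (All x (Imp p q)) (Imp p (All x q))"
| Refl: "wf_tm t \<Longrightarrow> T \<turnstile> Eq t t"
| Leibniz: "wf_fm p \<Longrightarrow> wf_tm s \<Longrightarrow> wf_tm t \<Longrightarrow> free_for x s p \<Longrightarrow> free_for x t p \<Longrightarrow>
      T \<turnstile> Imp (Eq s t) (Imp (subst x s p) (subst x t p))"
| MP: "T \<turnstile> Imp p q \<Longrightarrow> T \<turnstile> p \<Longrightarrow> T \<turnstile> q"
| Gen: "T \<turnstile> p \<Longrightarrow> T \<turnstile> All x p"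

abbreviation vars :: "nat \<Rightarrow> nat \<Rightarrow> tm list" where
  "vars m n \<equiv> map Var [m..<n]"

inductive_set PA :: "fm set" where
  Succ_not_Zero: "Imp (Eq (suc (Var 0)) zero) Bot \<in> PA"
| Succ_inject: "Imp (Eq (suc (Var 0)) (suc (Var 1))) (Eq (Var 0) (Var 1)) \<in> PA"
| Proj_eq: "wf_pr (Proj n k) \<Longrightarrow> Eq (Fn (Proj n k) (vars 0 n)) (Var k) \<in> PA"
| Comp_eq: "wf_pr (Comp n f gs) \<Longrightarrow>
    Eq (Fn (Comp n f gs) (vars 0 n)) (Fn f (map (\<lambda>g. Fn g (vars 0 n)) gs)) \<in> PA"
| PRec_Zero: "wf_pr (PRec f g) \<Longrightarrow> n = arity f \<Longrightarrow>
    Eq (Fn (PRec f g) (zero # vars 1 (Suc n))) (Fn f (vars 1 (Suc n))) \<in> PA"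
| PRec_Succ: "wf_pr (PRec f g) \<Longrightarrow> n = arity f \<Longrightarrow>
    Eq (Fn (PRec f g) (suc (Var 0) # vars 1 (Suc n)))
       (Fn g (Var 0 # Fn (PRec f g) (vars 0 (Suc n)) # vars 1 (Suc n))) \<in> PA"
| Induct: "wf_fm p \<Longrightarrow>
    Imp (subst x zero p) (Imp (All x (Imp p (subst x (suc (Var x)) p))) (All x p)) \<in> PA"

section \<open>Smullyan models\<close>

record 'a smullyan_model =
  alphabet :: "'a set"
  preds :: "'a list set"
  ext :: "'a list \<Rightarrow> 'a list set"

definition sents :: "'a set \<Rightarrow> 'a list set \<Rightarrow> 'a list set" where
  "sents A P = {H @ X | H X. H \<in> P \<and> X \<in> lists A}"

definition True_sents :: "'a smullyan_model \<Rightarrow> 'a list set" where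
  "True_sents M = {H @ X | H X. H \<in> preds M \<and> X \<in> ext M H}"

definition FPT :: "'a smullyan_model \<Rightarrow> bool" where
  "FPT M \<longleftrightarrow> (\<forall>H \<in> preds M. \<exists>S \<in> sents (alphabet M) (preds M) - preds M.
     S \<in> True_sents M \<longleftrightarrow> H @ S \<in> True_sents M)"

section \<open>The model based on Peano arithmetic\<close>

locale goedel_numbering =
  fixes v :: nat  \<comment> \<open>the distinguished variable\<close>
    and gn :: "fm \<Rightarrow> nat"
  assumes inj_gn: "inj_on gn {p. wf_fm p}"
begin

definition v_formula :: "fm \<Rightarrow> bool" where
  "v_formula p \<longleftrightarrow> wf_fm p \<and> fv p \<subseteq> {v}"

definition \<Gamma> :: "nat set" where
  "\<Gamma> = gn ` {p. v_formula p}"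

definition \<phi> :: "nat \<Rightarrow> fm" where
  "\<phi> i = (THE p. v_formula p \<and> gn p = i)"

definition d :: "nat \<Rightarrow> nat" where
  "d i = (if i \<in> \<Gamma> then gn (subst v (num i) (\<phi> i)) else 0)"

lemma phi_gn: "v_formula p \<Longrightarrow> \<phi> (gn p) = p"
  unfolding \<phi>_def
  by (rule the_equality) (auto simp: v_formula_def dest: inj_onD[OF inj_gn])

lemma phi: "i \<in> \<Gamma> \<Longrightarrow> v_formula (\<phi> i)" "i \<in> \<Gamma> \<Longrightarrow> gn (\<phi> i) = i"
  by (auto simp: \<Gamma>_def phi_gn)

end

datatype letter = R | A nat

text \<open>Any injective numbering for which the diagonal function is primitive recursive is
  allowed, as is any function symbol that denotes the diagonal function.\<close>

locale pa_frame = goedel_numbering +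
  fixes dsym :: pr
  assumes wf_dsym: "wf_pr dsym"
    and arity_dsym: "arity dsym = 1"
    and eval_dsym: "\<And>i. eval_pr dsym [i] = d i"
begin

definition Sigma_syms :: "letter set" where
  "Sigma_syms = insert R (A ` \<Gamma>)"

definition Pred :: "letter list set" where
  "Pred = {replicate j R @ [A i] | j i. i \<in> \<Gamma>}"

definition Sent :: "letter list set" where
  "Sent = sents Sigma_syms Pred"

definition Sent_plus :: "letter list set" where
  "Sent_plus = Sent - Pred"

fun I :: "letter list \<Rightarrow> fm" where
  "I [A i] = \<phi> i"
| "I [R, A i] = subst v (Fn dsym [Var v]) (\<phi> i)"
| "I _ = Bot"

lemma Pred_append_eq:
  assumes "H @ X = H' @ X'" "H \<in> Pred" "H' \<in> Pred"
  shows "H = H' \<and> X = X'"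
proof -
  obtain j i j' i' where H: "H = replicate j R @ [A i]" "H' = replicate j' R @ [A i']"
    using assms(2,3) by (auto simp: Pred_def)
  have "replicate j R @ A i # X = replicate j' R @ A i' # X' \<Longrightarrow> j = j' \<and> i = i' \<and> X = X'"
  proof (induction j arbitrary: j')
    case 0
    then show ?case by (cases j') auto
  next
    case (Suc j)
    then show ?case by (cases j') auto
  qed
  with assms(1) H show ?thesis by auto
qed

lemma A_in_Pred_iff: "[A i] \<in> Pred \<longleftrightarrow> i \<in> \<Gamma>"
  by (auto simp: Pred_def Cons_eq_append_conv intro: exI[of _ 0])

lemma R_in_Pred_iff: "R # H \<in> Pred \<longleftrightarrow> H \<in> Pred"
proof
  assume "R # H \<in> Pred"
  then obtain j i where "R # H = replicate j R @ [A i]" "i \<in> \<Gamma>" by (auto simp: Pred_def)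
  then show "H \<in> Pred" by (cases j) (auto simp: Pred_def)
next
  assume "H \<in> Pred"
  then obtain j i where "R # H = replicate (Suc j) R @ [A i]" "i \<in> \<Gamma>" by (auto simp: Pred_def)
  then show "R # H \<in> Pred" unfolding Pred_def by blast
qed

lemma Pred_nonempty: "H \<in> Pred \<Longrightarrow> H \<noteq> []"
  by (auto simp: Pred_def)

lemma Pred_cases:
  assumes "H \<in> Pred"
  obtains i where "i \<in> \<Gamma>" "H = [A i]" | H' where "H' \<in> Pred" "H = R # H'"
proof -
  obtain j i where H: "H = replicate j R @ [A i]" "i \<in> \<Gamma>"
    using assms by (auto simp: Pred_def)
  show thesis
  proof (cases j)
    case 0
    with H that(1) show ?thesis by simp
  next
    case (Suc k)
    with H that(2)[of "replicate k R @ [A i]"] show ?thesis by (auto simp: Pred_def)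
  qed
qed

lemma Pred_subset_Sent: "Pred \<subseteq> Sent"
  by (force simp: Sent_def sents_def)

lemma SentI: "H \<in> Pred \<Longrightarrow> X \<in> lists Sigma_syms \<Longrightarrow> H @ X \<in> Sent"
  by (auto simp: Sent_def sents_def)

lemma Sent_subset_lists: "Sent \<subseteq> lists Sigma_syms"
  by (auto simp: Sent_def sents_def Pred_def Sigma_syms_def)

lemma SentE:
  assumes "S \<in> Sent"
  obtains H X where "H \<in> Pred" "X \<in> lists Sigma_syms" "S = H @ X"
  using assms by (auto simp: Sent_def sents_def)

lemma Pred_append_iff:
  "H \<in> Pred \<Longrightarrow> H' \<in> Pred \<Longrightarrow> H @ X = H' @ X' \<longleftrightarrow> H = H' \<and> X = X'"
  "H \<in> Pred \<Longrightarrow> H @ X = A i # X' \<longleftrightarrow> H = [A i] \<and> X = X'"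
  "H \<in> Pred \<Longrightarrow> H' \<in> Pred \<Longrightarrow> H @ X = R # H' @ X' \<longleftrightarrow> H = R # H' \<and> X = X'"
  subgoal using Pred_append_eq by blast
  subgoal by (erule Pred_cases) auto
  subgoal using Pred_append_eq[of H X "R # H'" X'] R_in_Pred_iff[of H'] by auto
  done

lemma in_Sent:
  "H \<in> Pred \<Longrightarrow> X \<in> lists Sigma_syms \<Longrightarrow> H @ X \<in> Sent"
  "i \<in> \<Gamma> \<Longrightarrow> X \<in> lists Sigma_syms \<Longrightarrow> A i # X \<in> Sent"
  "H \<in> Pred \<Longrightarrow> X \<in> lists Sigma_syms \<Longrightarrow> R # H @ X \<in> Sent"
  using SentI[of H X] SentI[of "[A i]" X] SentI[of "R # H" X]
  by (auto simp: A_in_Pred_iff R_in_Pred_iff)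

lemma Sent_lists: "X \<in> Pred \<Longrightarrow> X \<in> Sent" "X \<in> Sent \<Longrightarrow> X \<in> lists Sigma_syms"
  using Sent_subset_lists Pred_subset_Sent by blast+

text \<open>\<open>J\<close> is only of interest on \<open>Sent\<close>; the last clause makes it total.\<close>

function J :: "letter list \<Rightarrow> fm" where
  "H \<in> Pred \<Longrightarrow> X \<in> Pred \<Longrightarrow> J (H @ X) = subst v (num (gn (I X))) (I H)"
| "i \<in> \<Gamma> \<Longrightarrow> X \<in> lists Sigma_syms - Sent \<Longrightarrow> J ([A i] @ X) = subst v zero (I [A i])"
| "H \<in> Pred \<Longrightarrow> X \<in> lists Sigma_syms - Sent \<Longrightarrow> J ((R # H) @ X) = Bot"
| "i \<in> \<Gamma> \<Longrightarrow> X \<in> Sent_plus \<Longrightarrow> J ([A i] @ X) = subst v (num (gn (J X))) (I [A i])"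
| "H \<in> Pred \<Longrightarrow> X \<in> Sent_plus \<Longrightarrow> J ((R # H) @ X) = Bot"
| "S \<notin> Sent \<Longrightarrow> J S = Bot"
proof goal_cases
  case (1 P S)
  note hyps = 1
  show P
  proof (cases "S \<in> Sent")
    case False
    with hyps(6) show P by blast
  next
    case True
    then obtain H X where HX: "H \<in> Pred" "X \<in> lists Sigma_syms" "S = H @ X"
      by (rule SentE)
    consider "X \<in> Pred" | "X \<in> lists Sigma_syms - Sent" | "X \<in> Sent_plus"
      using HX by (auto simp: Sent_plus_def)
    then show P
    proof cases
      case 1
      with HX hyps(1) show P by blast
    next
      case 2
      from HX(1) show P
        by (rule Pred_cases) (use HX(3) 2 hyps in auto)+
    next
      case 3
      from HX(1) show P
        by (rule Pred_cases) (use HX(3) 3 hyps in auto)+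
    qed
  qed
qed (auto simp: Pred_append_iff in_Sent in_Sent[unfolded in_lists_conv_set] Sent_lists Sent_plus_def
    simp del: in_lists_conv_set)
termination
  by (relation "measure length") auto

declare J.simps [simp del]

definition M_PA :: "letter smullyan_model" where
  "M_PA = \<lparr>alphabet = Sigma_syms, preds = Pred,
     ext = (\<lambda>H. {X \<in> lists Sigma_syms. PA \<turnstile> J (H @ X)})\<rparr>"

end

end

theory Submission
  imports Defs
begin

text \<open>Apply FPT to the predicate \<open>a\<^sub>i\<close>: it gives \<open>S \<in> Sent\<^sup>+\<close> such that \<open>S\<close> is true iff \<open>a\<^sub>i S\<close> is.
  As \<open>J(a\<^sub>i S)\<close> is \<open>\<phi>\<^sub>i\<close> applied to the code of \<open>J(S)\<close>, the sentence \<open>J(S)\<close> is the required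
  \<open>\<theta>\<close>.\<close>

lemma wf_num: "wf_tm (num n)"
  by (induction n) auto

lemma fv_num: "fv_tm (num n) = {}"
  by (induction n) auto

lemma wf_subst_tm: "wf_tm t \<Longrightarrow> wf_tm s \<Longrightarrow> wf_tm (subst_tm x s t)"
  by (induction t) auto

lemma fv_subst_tm: "fv_tm (subst_tm x s t) \<subseteq> (fv_tm t - {x}) \<union> fv_tm s"
proof (induction t)
  case (Fn f ts)
  then show ?case by fastforce
qed auto

lemma wf_subst: "wf_fm p \<Longrightarrow> wf_tm s \<Longrightarrow> wf_fm (subst x s p)"
  by (induction p) (auto simp: wf_subst_tm)

lemma fv_subst: "fv (subst x s p) \<subseteq> (fv p - {x}) \<union> fv_tm s"
proof (induction p)
  case (Eq t u)
  then show ?case using fv_subst_tm[of x s t] fv_subst_tm[of x s u] by auto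
qed auto

lemma sentence_Bot: "sentence Bot"
  by (simp add: sentence_def)

lemma (in goedel_numbering) sentence_subst:
  assumes "v_formula p" "wf_tm t" "fv_tm t = {}"
  shows "sentence (subst v t p)"
  using assms fv_subst[of v t p] by (auto simp: sentence_def v_formula_def wf_subst)

context pa_frame
begin

text \<open>Ensures that putting a closed term for \<open>v\<close> in \<open>I H\<close> yields a
  sentence.\<close>

lemma v_formula_I:
  assumes "H \<in> Pred"
  shows "v_formula (I H)"
proof -
  have Bot: "v_formula Bot"
    by (simp add: v_formula_def)
  obtain j i where H: "H = replicate j R @ [A i]" and i: "i \<in> \<Gamma>"
    using assms by (auto simp: Pred_def)
  \<comment> \<open>The cases match the three clauses of \<open>I\<close>.\<close>
  consider "j = 0" | "j = 1" | k where "j = Suc (Suc k)"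
    by (metis One_nat_def not0_implies_Suc)
  then show ?thesis
  proof cases
    case 1
    then show ?thesis using H phi(1)[OF i] by simp
  next
    case 2
    have "wf_tm (Fn dsym [Var v])"
      using wf_dsym arity_dsym by simp
    \<comment> \<open>The substituted term has \<open>v\<close> as its only variable, so no new free
      variable appears.\<close>
    then have "v_formula (subst v (Fn dsym [Var v]) (\<phi> i))"
      using phi(1)[OF i] fv_subst[of v "Fn dsym [Var v]" "\<phi> i"]
      unfolding v_formula_def by (auto intro: wf_subst)
    then show ?thesis
      using 2 H by simp
  next
    case 3
    then show ?thesis using H Bot by simp
  qed
qed

text \<open>Each clause of \<open>J\<close> gives \<open>Bot\<close> or puts a closed term, zero or
  a numeral, for \<open>v\<close> in a v-formula.\<close>

lemma sentence_J: "sentence (J S)"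
proof (induction S rule: J.induct)
  case (1 H X)
  then show ?case
    by (simp add: J.simps(1) sentence_subst v_formula_I wf_num fv_num)
next
  case (2 i X)
  then show ?case
    using J.simps(2)[of i X] by (simp add: sentence_subst phi)
next
  case (3 H X)
  then show ?case
    by (simp only: J.simps(3) sentence_Bot)
next
  case (4 i X)
  then show ?case
    using J.simps(4)[of i X] by (simp add: sentence_subst phi wf_num fv_num)
next
  case (5 H X)
  then show ?case
    by (simp only: J.simps(5) sentence_Bot)
next
  case (6 S)
  then show ?case
    by (simp add: J.simps(6) sentence_Bot)
qed

text \<open>\<open>ext\<close> tests \<open>J\<close> on the whole string \<open>H @ X\<close>, so
  the result does not depend on how \<open>S\<close> is split; membership in \<open>Sent\<close>
  supplies a split.\<close>

lemma True_M_PA_iff: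
  assumes "S \<in> Sent"
  shows "S \<in> True_sents M_PA \<longleftrightarrow> PA \<turnstile> J S"
  using assms by (elim SentE) (auto simp: True_sents_def M_PA_def)

lemma FPT_fixed_point:
  assumes "FPT M_PA" "i \<in> \<Gamma>"
  shows "\<exists>\<theta>. sentence \<theta> \<and> (PA \<turnstile> \<theta> \<longleftrightarrow> PA \<turnstile> subst v (num (gn \<theta>)) (\<phi> i))"
proof -
  obtain S where S: "S \<in> Sent_plus"
    and iff: "S \<in> True_sents M_PA \<longleftrightarrow> [A i] @ S \<in> True_sents M_PA"
    using assms A_in_Pred_iff[of i]
    by (auto simp: FPT_def M_PA_def Sent_plus_def Sent_def)
  have "S \<in> Sent" "[A i] @ S \<in> Sent"
    using S assms(2) Sent_lists(2)[of S] in_Sent(2)[of i S] by (auto simp: Sent_plus_def)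
  \<comment> \<open>Since \<open>S\<close> lies outside \<open>Pred\<close>, the fourth clause of
    \<open>J\<close> applies: the argument is the code of \<open>J S\<close>, not of
    \<open>I S\<close>.\<close>
  then have "PA \<turnstile> J S \<longleftrightarrow> PA \<turnstile> subst v (num (gn (J S))) (\<phi> i)"
    using iff J.simps(4)[OF assms(2) S] by (simp only: True_M_PA_iff I.simps)
  then show ?thesis using sentence_J by blast
qed

end

theorem theorem5p15:
  fixes v :: nat and gn :: "fm \<Rightarrow> nat" and dsym :: pr and i :: nat
  assumes "pa_frame v gn dsym"
    and "FPT (pa_frame.M_PA v gn dsym)"
    and "i \<in> goedel_numbering.\<Gamma> v gn"
  shows "\<exists>\<theta>. sentence \<theta> \<and>
    (PA \<turnstile> \<theta> \<longleftrightarrow> PA \<turnstile> subst v (num (gn \<theta>)) (goedel_numbering.\<phi> v gn i))"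
  using pa_frame.FPT_fixed_point[OF assms] .

end
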